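(* Let $C\in\mathbb{Z}_{>0}$ and let $\Gamma$ be a graph with a fixed base vertex $v_0$, such that each vertex in $\Gamma$ has degree at most $C$. For each $n\in\mathbb{Z}_{\ge 0}$, let $t_n$ be the number of loops of length $n$ in $\Gamma$ which start and end at $v_0$. Then there exists a probability measure $\mu$ on $[0,\infty)$ such that for each $n\in\mathbb{Z}_{\ge 0}$ the $n$th moment of $\mu$ is equal to $t_{2n}$, i.e. $\int_0^\infty x^n\,d\mu(x)=t_{2n}$. In other words, $t_0,t_2,t_4,\ldots$ is a Stieltjes moment sequence. Moreover, $\mu$ is unique and its support is contained in the interval $[0,C^2]$.
   Context: Graphs are undirected. A loop of length $n$ which starts and ends at $v_0$ means a closed walk of length $n$ from $v_0$ to $v_0$ (vertices and edges may be repeated); in particular $t_0=1$. A sequence $a_0,a_1,\ldots$ of real numbers is a Stieltjes moment sequence if there is a positive measure $\mu$ on $[0,\infty)$ with $a_n=\int x^n\,d\mu(x)$ for all $n\ge 0$. *)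

theory Defs
  imports "HOL-Probability.Probability"
begin

text \<open>
  Undirected graphs, possibly infinite, possibly with parallel edges and self-edges.
  An edge is attached to its unordered set of endpoints, which is a singleton for a
  self-edge. A simple graph is the case where \<open>E\<close> is a set of two-element
  subsets of \<open>V\<close> and \<open>ends\<close> is the identity.
\<close>

locale undirected_graph =
  fixes V :: "'v set" and E :: "'e set" and ends :: "'e \<Rightarrow> 'v set"
  assumes ends_subset: "e \<in> E \<Longrightarrow> ends e \<subseteq> V"
    and card_ends: "e \<in> E \<Longrightarrow> card (ends e) = 1 \<or> card (ends e) = 2"

definition incident_edges :: "'e set \<Rightarrow> ('e \<Rightarrow> 'v set) \<Rightarrow> 'v \<Rightarrow> 'e set" where
  "incident_edges E ends v = {e \<in> E. v \<in> ends e}"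

text \<open>
  Finiteness is required explicitly because \<^const>\<open>card\<close> is 0 on infinite sets.
  A self-edge contributes 1 to the degree. If it is counted twice instead, the bound
  below is a consequence of the bound in that convention; without self-edges the two
  conventions agree.
\<close>

definition degree_at_most :: "'e set \<Rightarrow> ('e \<Rightarrow> 'v set) \<Rightarrow> nat \<Rightarrow> 'v \<Rightarrow> bool" where
  "degree_at_most E ends C v \<longleftrightarrow>
     finite (incident_edges E ends v) \<and> card (incident_edges E ends v) \<le> C"

text \<open>
  A closed walk is recorded by its list of \<open>n + 1\<close> vertices together with its
  list of \<open>n\<close> edges, so that walks using different parallel edges are
  different.
\<close>

definition closed_walks ::
    "'e set \<Rightarrow> ('e \<Rightarrow> 'v set) \<Rightarrow> 'v \<Rightarrow> nat \<Rightarrow> ('v list \<times> 'e list) set" where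
  "closed_walks E ends v0 n =
     {(vs, es). length vs = Suc n \<and> length es = n \<and> vs ! 0 = v0 \<and> vs ! n = v0 \<and>
        (\<forall>i<n. es ! i \<in> E \<and> ends (es ! i) = {vs ! i, vs ! Suc i})}"

definition num_loops :: "'e set \<Rightarrow> ('e \<Rightarrow> 'v set) \<Rightarrow> 'v \<Rightarrow> nat \<Rightarrow> nat" where
  "num_loops E ends v0 n = card (closed_walks E ends v0 n)"

lemma num_loops_0: "num_loops E ends v0 0 = 1"
proof -
  have "closed_walks E ends v0 0 = {([v0], [])}"
    by (auto simp: closed_walks_def length_Suc_conv)
  then show ?thesis
    by (simp add: num_loops_def)
qed

definition borel_measure_on_nonneg :: "real measure \<Rightarrow> bool" where
  "borel_measure_on_nonneg \<mu> \<longleftrightarrow> sets \<mu> = sets (restrict_space borel {0..})"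

text \<open>Finiteness of every moment is part of \<^const>\<open>has_bochner_integral\<close>.\<close>

definition has_moments :: "real measure \<Rightarrow> (nat \<Rightarrow> real) \<Rightarrow> bool" where
  "has_moments \<mu> a \<longleftrightarrow> (\<forall>n. has_bochner_integral \<mu> (\<lambda>x. x ^ n) (a n))"

definition stieltjes_moment_sequence :: "(nat \<Rightarrow> real) \<Rightarrow> bool" where
  "stieltjes_moment_sequence a \<longleftrightarrow> (\<exists>\<mu>. borel_measure_on_nonneg \<mu> \<and> has_moments \<mu> a)"

definition measure_support :: "'a::topological_space measure \<Rightarrow> 'a set" where
  "measure_support \<mu> =
     {x \<in> space \<mu>. \<forall>U. open U \<longrightarrow> x \<in> U \<longrightarrow> emeasure \<mu> (U \<inter> space \<mu>) > 0}"

end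

theory Submission
  imports Defs "HOL-Real_Asymp.Real_Asymp"
begin

text \<open>
  Let \<open>A\<close> be the adjacency operator divided by \<open>C\<close>; by the degree bound it
  is a symmetric contraction. With \<open>e\<close> the indicator of the base vertex,
  \<open>s n = t (2 * n) / C ^ (2 * n)\<close> equals \<open>\<langle>A\<^sup>2\<^sup>n e, e\<rangle>\<close>, and the
  \<open>l\<close>-th difference of \<open>s\<close> at \<open>k\<close> is
  \<open>\<langle>(1 - A\<^sup>2)\<^sup>l A\<^sup>2\<^sup>k e, e\<rangle>\<close>. This is a square norm when \<open>l\<close> is even and of
  the form \<open>\<langle>(1 - A\<^sup>2) g, g\<rangle>\<close> when \<open>l\<close> is odd, hence nonnegative in both
  cases. Only finitely many vertices matter for given \<open>k\<close> and \<open>l\<close>, so no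
  Hilbert space is needed.

  By Hausdorff's theorem \<open>s\<close> is then the moment sequence of a probability measure on
  the unit interval: the differences, weighted by binomial coefficients, are the masses at
  \<open>k / n\<close> of atomic measures whose moments tend to \<open>s\<close>, and Helly's theorem
  yields a weak limit. Rescaling by \<open>C\<^sup>2\<close> gives the required measure. It is unique because
  the moments grow at most geometrically and so determine the characteristic function.
\<close>

section \<open>Iterated differences and Bernstein weights\<close>

text \<open>The sign is \<open>(-1)^l\<close> relative to the forward difference. For moments of a
  finite measure on the unit interval the value is the integral of \<open>(1 - x)^l * x^k\<close>,
  hence nonnegative.\<close>

primrec backward_difference :: "nat \<Rightarrow> (nat \<Rightarrow> real) \<Rightarrow> nat \<Rightarrow> real" where
  "backward_difference 0 s k = s k"
| "backward_difference (Suc l) s k = backward_difference l s k - backward_difference l s (Suc k)"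

text \<open>Locality of the differences: it later allows an infinite graph to be replaced by a
  finite piece that depends on \<open>k\<close> and \<open>l\<close>.\<close>

lemma backward_difference_cong:
  assumes "\<And>j. j \<le> k + l \<Longrightarrow> s j = s' j"
  shows "backward_difference l s k = backward_difference l s' k"
  using assms by (induction l arbitrary: k) simp_all

lemma sum_Suc_choose:
  fixes f :: "nat \<Rightarrow> real"
  shows "(\<Sum>k\<le>Suc n. real (Suc n choose k) * f k) = (\<Sum>k\<le>n. real (n choose k) * (f k + f (Suc k)))"
proof -
  have "(\<Sum>k\<le>Suc n. real (Suc n choose k) * f k)
      = f 0 + (\<Sum>k\<le>n. real (n choose Suc k) * f (Suc k)) + (\<Sum>k\<le>n. real (n choose k) * f (Suc k))"
    by (subst sum.atMost_Suc_shift) (simp add: algebra_simps sum.distrib)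
  also have "f 0 + (\<Sum>k\<le>n. real (n choose Suc k) * f (Suc k)) = (\<Sum>k\<le>Suc n. real (n choose k) * f k)"
    by (subst sum.atMost_Suc_shift) simp
  also have "\<dots> = (\<Sum>k\<le>n. real (n choose k) * f k)"
    by simp
  finally show ?thesis
    by (simp add: algebra_simps sum.distrib)
qed

text \<open>On moments this is the expansion of \<open>x^m * (x + (1 - x))^n\<close>. In general,
  Pascal's rule pairs neighbouring terms, and each pair collapses by the recursion of the
  differences.\<close>

lemma sum_choose_backward_difference:
  "(\<Sum>k\<le>n. real (n choose k) * backward_difference (n - k) s (k + m)) = s m"
proof (induction n)
  case (Suc n)
  have "backward_difference (Suc n - k) s (k + m) + backward_difference (Suc n - Suc k) s (Suc k + m)
      = backward_difference (n - k) s (k + m)" if "k \<le> n" for k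
    using that by (simp add: Suc_diff_le)
  then have "(\<Sum>k\<le>n. real (n choose k) *
        (backward_difference (Suc n - k) s (k + m) + backward_difference (Suc n - Suc k) s (Suc k + m)))
      = (\<Sum>k\<le>n. real (n choose k) * backward_difference (n - k) s (k + m))"
    by (intro sum.cong refl arg_cong2[where f = "(*)"]) simp
  then show ?case
    using Suc by (simp only: sum_Suc_choose)
qed simp

text \<open>Each factor is absorbed by the identity
  \<open>k * (n choose k) = n * ((n - 1) choose (k - 1))\<close>, with both arguments lowered by
  \<open>i\<close>.\<close>

lemma choose_times_falling_ratio:
  assumes "m \<le> k" "k \<le> n"
  shows "real (n choose k) * (\<Prod>i<m. (real k - real i) / (real n - real i)) = real ((n - m) choose (k - m))"
  using assms
proof (induction m)
  case (Suc m)
  have "(k - m) * ((n - m) choose (k - m)) = (n - m) * ((n - m - 1) choose (k - m - 1))"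
    using Suc.prems by (intro times_binomial_minus1_eq) simp
  then have "real (k - m) * real ((n - m) choose (k - m)) = real (n - m) * real ((n - Suc m) choose (k - Suc m))"
    by (metis Suc_eq_plus1 diff_diff_left of_nat_mult)
  then show ?case
    using Suc by (simp add: of_nat_diff field_simps)
qed simp

text \<open>With falling factorials in place of the powers \<open>(k / n)^m\<close>, the Bernstein
  weights reproduce \<open>s m\<close> exactly and not only in the limit.\<close>

lemma sum_falling_ratio:
  assumes "m \<le> n"
  shows "(\<Sum>k\<le>n. real (n choose k) * backward_difference (n - k) s k *
            (\<Prod>i<m. (real k - real i) / (real n - real i))) = s m"
proof -
  let ?r = "\<lambda>k. \<Prod>i<m. (real k - real i) / (real n - real i)"
  \<comment> \<open>The factor with \<open>i = k\<close> vanishes.\<close>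
  have "?r k = 0" if "k < m" for k
    using that by (auto intro!: prod_zero)
  then have "(\<Sum>k\<le>n. real (n choose k) * backward_difference (n - k) s k * ?r k)
      = (\<Sum>k=m..n. real (n choose k) * backward_difference (n - k) s k * ?r k)"
    by (intro sum.mono_neutral_right) auto
  also have "\<dots> = (\<Sum>k=m..n. real ((n - m) choose (k - m)) * backward_difference (n - k) s k)"
    by (intro sum.cong refl) (simp flip: choose_times_falling_ratio add: mult_ac)
  also have "\<dots> = (\<Sum>k\<le>n - m. real ((n - m) choose k) * backward_difference (n - m - k) s (k + m))"
    using assms by (intro sum.reindex_bij_witness[of _ "\<lambda>k. k + m" "\<lambda>k. k - m"]) auto
  also have "\<dots> = s m"
    by (rule sum_choose_backward_difference)
  finally show ?thesis .
qed

text \<open>Both sides are products of \<open>m\<close> factors of absolute value at most 1, so they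
  differ by at most the sum of the differences of the factors.\<close>

lemma falling_ratio_approx:
  assumes "2 * m < n" "k \<le> n"
  shows "\<bar>(real k / real n) ^ m - (\<Prod>i<m. (real k - real i) / (real n - real i))\<bar>
           \<le> real m * (real m / (real n - real m))"
proof -
  \<comment> \<open>The numerator is negative for \<open>k < i\<close>; then
    \<open>2 * m < n\<close> gives \<open>i - k \<le> n - i\<close>.\<close>
  have ratio: "\<bar>(real k - real i) / (real n - real i)\<bar> \<le> 1" if "i < m" for i
    using that assms by (simp add: abs_le_iff divide_simps)
  have "\<bar>real k / real n - (real k - real i) / (real n - real i)\<bar> \<le> real m / (real n - real m)"
    if "i < m" for i
  proof -
    have "real k / real n - (real k - real i) / (real n - real i)
        = real i / (real n - real i) * ((real n - real k) / real n)"
      using that assms by (simp add: field_simps)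
    then have "\<bar>real k / real n - (real k - real i) / (real n - real i)\<bar> = real i / (real n - real i) * ((real n - real k) / real n)"
      using that assms by simp
    also have "\<dots> \<le> real i / (real n - real i) * 1"
      using that assms by (intro mult_left_mono) auto
    also have "\<dots> \<le> real m / (real n - real m)"
      using that assms by (simp add: frac_le)
    finally show ?thesis .
  qed
  then have "norm ((\<Prod>i<m. real k / real n) - (\<Prod>i<m. (real k - real i) / (real n - real i)))
      \<le> (\<Sum>i<m. real m / (real n - real m))"
    using assms ratio
    by (intro order_trans[OF norm_prod_diff] sum_mono) (auto simp: divide_simps)
  then show ?thesis
    by simp
qed

section \<open>Symmetric contractions\<close>

text \<open>Only the columns are cut down to \<open>S\<close>. The row index is unrestricted, so
  operator identities are plain equalities of functions without membership conditions.\<close>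

definition sum_operator :: "'v set \<Rightarrow> ('v \<Rightarrow> 'v \<Rightarrow> real) \<Rightarrow> ('v \<Rightarrow> real) \<Rightarrow> 'v \<Rightarrow> real" where
  "sum_operator S a f u = (\<Sum>x\<in>S. a u x * f x)"

definition sum_inner :: "'v set \<Rightarrow> ('v \<Rightarrow> real) \<Rightarrow> ('v \<Rightarrow> real) \<Rightarrow> real" where
  "sum_inner S f g = (\<Sum>x\<in>S. f x * g x)"

text \<open>The operator \<open>1 - A\<^sup>2\<close>, which for symmetric \<open>A\<close> is the
  defect operator of a contraction.\<close>

definition defect :: "(('v \<Rightarrow> real) \<Rightarrow> 'v \<Rightarrow> real) \<Rightarrow> ('v \<Rightarrow> real) \<Rightarrow> 'v \<Rightarrow> real" where
  "defect A f = (\<lambda>u. f u - A (A f) u)"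

lemma sum_inner_diff_left: "sum_inner S (\<lambda>u. f u - g u) h = sum_inner S f h - sum_inner S g h"
  by (simp add: sum_inner_def algebra_simps sum_subtractf)

lemma sum_inner_commute: "sum_inner S f g = sum_inner S g f"
  by (simp add: sum_inner_def mult.commute)

lemma sum_inner_nonneg: "sum_inner S f f \<ge> 0"
  by (simp add: sum_inner_def sum_nonneg)

locale symmetric_contraction =
  fixes S :: "'v set" and a :: "'v \<Rightarrow> 'v \<Rightarrow> real"
  assumes finite: "finite S"
    and symmetric: "a u x = a x u"
    and nonneg: "a u x \<ge> 0"
    and row_sum: "u \<in> S \<Longrightarrow> (\<Sum>x\<in>S. a u x) \<le> 1"
begin

abbreviation "A \<equiv> sum_operator S a"
abbreviation "P \<equiv> defect A"

lemma A_diff: "A (\<lambda>u. f u - g u) = (\<lambda>u. A f u - A g u)"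
  by (simp add: sum_operator_def algebra_simps sum_subtractf fun_eq_iff)

lemma P_A: "P (A f) = A (P f)"
  by (simp add: defect_def A_diff)

lemma P_diff: "P (\<lambda>u. f u - g u) = (\<lambda>u. P f u - P g u)"
  by (simp add: defect_def A_diff fun_eq_iff)

lemma funpow_P_diff: "(P ^^ l) (\<lambda>u. f u - g u) = (\<lambda>u. (P ^^ l) f u - (P ^^ l) g u)"
  by (induction l) (simp_all add: P_diff)

lemma P_funpow_A: "P ((A ^^ k) f) = (A ^^ k) (P f)"
  by (induction k) (simp_all add: P_A)

lemma funpow_P_funpow_A: "(P ^^ l) ((A ^^ k) f) = (A ^^ k) ((P ^^ l) f)"
  by (induction l) (simp_all add: P_funpow_A)

lemma inner_A: "sum_inner S (A f) g = sum_inner S f (A g)"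
proof -
  have "sum_inner S (A f) g = (\<Sum>u\<in>S. \<Sum>x\<in>S. a u x * f x * g u)"
    by (simp add: sum_inner_def sum_operator_def sum_distrib_right)
  also have "\<dots> = (\<Sum>x\<in>S. \<Sum>u\<in>S. a u x * f x * g u)"
    by (rule sum.swap)
  also have "\<dots> = sum_inner S f (A g)"
    by (simp add: sum_inner_def sum_operator_def sum_distrib_left symmetric mult_ac)
  finally show ?thesis .
qed

lemma inner_P: "sum_inner S (P f) g = sum_inner S f (P g)"
  by (simp add: defect_def sum_inner_diff_left sum_inner_commute[of S f] inner_A)

lemma inner_funpow_A: "sum_inner S ((A ^^ k) f) g = sum_inner S f ((A ^^ k) g)"
  by (induction k arbitrary: g) (simp_all add: inner_A, simp add: funpow_swap1)

lemma inner_funpow_P: "sum_inner S ((P ^^ l) f) g = sum_inner S f ((P ^^ l) g)"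
  by (induction l arbitrary: g) (simp_all add: inner_P, simp add: funpow_swap1)

text \<open>Schur's test: Cauchy-Schwarz with the weights \<open>a u x\<close> uses up the row sums,
  and after exchanging the sums, symmetry turns the column sums into row sums.\<close>

lemma A_contraction: "sum_inner S (A f) (A f) \<le> sum_inner S f f"
proof -
  have "(A f u)\<^sup>2 \<le> (\<Sum>x\<in>S. a u x * (f x)\<^sup>2)" if "u \<in> S" for u
  proof -
    have "(A f u)\<^sup>2 = (\<Sum>x\<in>S. sqrt (a u x) * (sqrt (a u x) * f x))\<^sup>2"
      using nonneg by (simp add: sum_operator_def flip: mult.assoc)
    also have "\<dots> \<le> (\<Sum>x\<in>S. (sqrt (a u x))\<^sup>2) * (\<Sum>x\<in>S. (sqrt (a u x) * f x)\<^sup>2)"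
      by (rule Cauchy_Schwarz_ineq_sum)
    also have "\<dots> = (\<Sum>x\<in>S. a u x) * (\<Sum>x\<in>S. a u x * (f x)\<^sup>2)"
      using nonneg by (simp add: power_mult_distrib)
    also have "\<dots> \<le> 1 * (\<Sum>x\<in>S. a u x * (f x)\<^sup>2)"
      using row_sum[OF that] nonneg by (intro mult_right_mono) (auto intro: sum_nonneg)
    finally show ?thesis by simp
  qed
  then have "sum_inner S (A f) (A f) \<le> (\<Sum>u\<in>S. \<Sum>x\<in>S. a u x * (f x)\<^sup>2)"
    by (auto simp: sum_inner_def power2_eq_square intro: sum_mono)
  also have "\<dots> = (\<Sum>x\<in>S. (\<Sum>u\<in>S. a x u) * (f x)\<^sup>2)"
    by (subst sum.swap) (simp add: sum_distrib_right symmetric)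
  also have "\<dots> \<le> (\<Sum>x\<in>S. 1 * (f x)\<^sup>2)"
    using row_sum by (intro sum_mono mult_right_mono) auto
  finally show ?thesis
    by (simp add: sum_inner_def power2_eq_square)
qed

text \<open>By symmetry of \<open>A\<close> the form is the square norm of \<open>f\<close> minus
  that of \<open>A f\<close>.\<close>

lemma inner_P_nonneg: "sum_inner S (P f) f \<ge> 0"
  using A_contraction[of f] by (simp add: defect_def sum_inner_diff_left inner_A)

lemma backward_difference_inner:
  "backward_difference l (\<lambda>n. sum_inner S ((A ^^ (2 * n)) e) e) k
     = sum_inner S ((P ^^ l) ((A ^^ (2 * k)) e)) e"
proof (induction l arbitrary: k)
  case (Suc l)
  have "(P ^^ Suc l) ((A ^^ (2 * k)) e) = (P ^^ l) (P ((A ^^ (2 * k)) e))"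
    by (simp add: funpow_swap1)
  \<comment> \<open>Only the innermost \<open>P\<close> is expanded; linearity of
    \<open>P ^^ l\<close> then yields the two terms of the recursion.\<close>
  also have "\<dots> = (\<lambda>u. (P ^^ l) ((A ^^ (2 * k)) e) u - (P ^^ l) ((A ^^ (2 * Suc k)) e) u)"
    unfolding defect_def[of A "(A ^^ (2 * k)) e"] funpow_P_diff by simp
  finally show ?case
    using Suc by (simp add: sum_inner_diff_left)
qed simp

lemma backward_difference_inner_nonneg:
  "backward_difference l (\<lambda>n. sum_inner S ((A ^^ (2 * n)) e) e) k \<ge> 0"
proof -
  define g where "g = (P ^^ (l div 2)) ((A ^^ k) e)"
  \<comment> \<open>Here \<open>i\<close> will be the parity of \<open>l\<close> and
    \<open>j\<close> its half. The operators commute and are self-adjoint, so half of the factors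
    can move to the other side.\<close>
  have split: "sum_inner S ((P ^^ i) ((P ^^ (2 * j)) ((A ^^ (2 * k)) e))) e
      = sum_inner S ((P ^^ i) ((P ^^ j) ((A ^^ k) e))) ((P ^^ j) ((A ^^ k) e))" for i j
  proof -
    have commute: "(P ^^ i) ((P ^^ j) f) = (P ^^ j) ((P ^^ i) f)" for f
      by (metis add.commute comp_apply funpow_add)
    have double: "F ^^ (2 * m) = F ^^ m \<circ> F ^^ m" for F :: "('v \<Rightarrow> real) \<Rightarrow> 'v \<Rightarrow> real" and m
      by (metis funpow_add mult_2)
    have "(P ^^ i) ((P ^^ (2 * j)) ((A ^^ (2 * k)) e))
        = (A ^^ k) ((P ^^ j) ((P ^^ i) ((P ^^ j) ((A ^^ k) e))))"
      by (simp add: double funpow_P_funpow_A commute)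
    then show ?thesis
      by (simp add: inner_funpow_A inner_funpow_P)
  qed
  show ?thesis
  proof (cases "even l")
    case True
    then have "l = 2 * (l div 2)" by simp
    then have "sum_inner S ((P ^^ l) ((A ^^ (2 * k)) e)) e = sum_inner S g g"
      using split[of 0 "l div 2"] by (simp add: g_def)
    then show ?thesis
      by (simp add: backward_difference_inner sum_inner_nonneg)
  next
    case False
    then have "l = Suc (2 * (l div 2))" by simp
    then have "sum_inner S ((P ^^ l) ((A ^^ (2 * k)) e)) e = sum_inner S (P g) g"
      using split[of 1 "l div 2"] by (metis funpow.simps(2) comp_apply funpow_0 One_nat_def g_def)
    then show ?thesis
      by (simp add: backward_difference_inner inner_P_nonneg)
  qed
qed

end

section \<open>Moment problems\<close>

text \<open>If \<open>s\<close> comes from a law on the unit interval, \<open>p\<close> is the law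
  of the number of successes in \<open>n\<close> trials whose success probability is drawn from
  it.\<close>

lemma bernstein_pmf:
  assumes "s 0 = 1" "\<And>l k. backward_difference l s k \<ge> 0"
  obtains p :: "nat pmf" where
    "\<And>k. pmf p k = real (n choose k) * backward_difference (n - k) s k" "set_pmf p \<subseteq> {..n}"
proof
  define w where "w k = real (n choose k) * backward_difference (n - k) s k" for k
  have w_nonneg: "w k \<ge> 0" for k
    using assms(2) by (simp add: w_def)
  \<comment> \<open>For \<open>k > n\<close> the truncated \<open>n - k\<close> is 0, but the
    binomial coefficient vanishes, so the weights live on \<open>{..n}\<close>.\<close>
  have "(\<integral>\<^sup>+ k. ennreal (w k) \<partial>count_space UNIV) = (\<Sum>k\<le>n. ennreal (w k))"
    by (intro nn_integral_count_space') (auto simp: w_def not_le binomial_eq_0)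
  also have "\<dots> = ennreal (\<Sum>k\<le>n. w k)"
    using w_nonneg by simp
  also have "(\<Sum>k\<le>n. w k) = 1"
    using sum_choose_backward_difference[of n s 0] assms(1) by (simp add: w_def)
  finally have pmf: "pmf (embed_pmf w) k = w k" for k
    using w_nonneg by (intro pmf_embed_pmf) auto
  show "pmf (embed_pmf w) k = real (n choose k) * backward_difference (n - k) s k" for k
    by (simp add: pmf w_def)
  show "set_pmf (embed_pmf w) \<subseteq> {..n}"
    by (auto simp: set_pmf_eq pmf w_def)
qed

lemma bernstein_moment_approx:
  fixes p :: "nat pmf"
  assumes pmf: "\<And>k. pmf p k = real (n choose k) * backward_difference (n - k) s k"
    and set: "set_pmf p \<subseteq> {..n}"
    and "2 * m < n"
  shows "\<bar>(\<integral>k. (real k / real n) ^ m \<partial>measure_pmf p) - s m\<bar> \<le> real m * (real m / (real n - real m))"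
proof -
  let ?r = "\<lambda>k. \<Prod>i<m. (real k - real i) / (real n - real i)"
  have int: "(\<integral>k. f k \<partial>measure_pmf p) = (\<Sum>k\<le>n. f k * pmf p k)" for f :: "nat \<Rightarrow> real"
    using set by (intro integral_measure_pmf_real) auto
  have "s m = (\<Sum>k\<le>n. ?r k * pmf p k)"
    using sum_falling_ratio[of m n s] assms(3) by (simp add: pmf mult_ac)
  then have "\<bar>(\<integral>k. (real k / real n) ^ m \<partial>measure_pmf p) - s m\<bar>
      = \<bar>\<Sum>k\<le>n. ((real k / real n) ^ m - ?r k) * pmf p k\<bar>"
    by (simp add: int left_diff_distrib sum_subtractf)
  also have "\<dots> \<le> (\<Sum>k\<le>n. real m * (real m / (real n - real m)) * pmf p k)"
    using falling_ratio_approx[OF assms(3)]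
    by (intro order_trans[OF sum_abs] sum_mono) (simp add: abs_mult mult_right_mono del: times_divide_eq_right times_divide_eq_left)
  also have "\<dots> = real m * (real m / (real n - real m)) * (\<Sum>k\<le>n. pmf p k)"
    by (simp add: sum_distrib_left)
  also have "(\<Sum>k\<le>n. pmf p k) = 1"
    using set by (intro sum_pmf_eq_1) auto
  finally show ?thesis by simp
qed

theorem hausdorff_moment_problem:
  assumes "s 0 = 1" "\<And>l k. backward_difference l s k \<ge> 0"
  obtains M where "real_distribution M" "AE x in M. x \<in> {0..1}" "has_moments M s"
proof -
  have "\<exists>p. (\<forall>k. pmf p k = real (n choose k) * backward_difference (n - k) s k) \<and> set_pmf p \<subseteq> {..n}" for n
    using bernstein_pmf[of s n] assms by metis
  then obtain p where pmf: "\<And>n k. pmf (p n) k = real (n choose k) * backward_difference (n - k) s k"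
    and set: "\<And>n. set_pmf (p n) \<subseteq> {..n}"
    by metis
  \<comment> \<open>\<open>\<mu> 0\<close> is the point mass at 0, since \<open>0 / 0 = 0\<close>;
    it lives on the unit interval like the others.\<close>
  define \<mu> where "\<mu> n = distr (measure_pmf (p n)) borel (\<lambda>k. real k / real n)" for n
  have \<mu>: "real_distribution (\<mu> n)" for n
    unfolding \<mu>_def by (intro prob_space.real_distribution_distr measure_pmf.prob_space_axioms) simp
  have \<mu>_AE: "AE x in \<mu> n. x \<in> {0..1}" for n
    using set[of n] unfolding \<mu>_def
    by (subst AE_distr_iff) (auto simp: AE_measure_pmf_iff divide_le_eq_1)
  have "tight \<mu>"
    unfolding tight_def
  proof (intro conjI allI impI)
    fix \<epsilon> :: real assume "\<epsilon> > 0"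
    \<comment> \<open>Tightness is phrased with intervals open on the left, so the left end must lie
      below 0 to catch an atom there.\<close>
    have "measure (\<mu> n) {-1<..1} = 1" for n
    proof -
      interpret real_distribution "\<mu> n" by (rule \<mu>)
      show ?thesis
        using \<mu>_AE[of n] by (subst prob_eq_1) (auto elim: eventually_mono)
    qed
    then show "\<exists>a b. a < b \<and> (\<forall>n. measure (\<mu> n) {a<..b} > 1 - \<epsilon>)"
      using \<open>\<epsilon> > 0\<close> by (intro exI[of _ "-1"] exI[of _ 1]) simp
  qed (rule \<mu>)
  from tight_imp_convergent_subsubsequence[OF this strict_mono_id]
  obtain r M where r: "strict_mono r" and M: "real_distribution M"
    and conv: "weak_conv_m (\<lambda>n. \<mu> (r n)) M"
    by (auto simp: comp_def)
  interpret M: real_distribution M by (rule M)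
  have limit: "(\<lambda>n. \<integral>x. f x \<partial>\<mu> (r n)) \<longlonglongrightarrow> (\<integral>x. f x \<partial>M)"
    if "\<And>x. isCont f x" "\<And>x. \<bar>f x\<bar> \<le> 1" for f :: "real \<Rightarrow> real"
    using weak_conv_imp_integral_bdd_continuous_conv[OF \<mu> M conv, of f 1] that by simp

  text \<open>\<open>d\<close> is a bounded continuous function vanishing exactly on the unit interval.\<close>
  define d where "d x = min 1 (max (- x) (max 0 (x - 1)))" for x :: real
  have d_cont: "isCont d x" for x
    unfolding d_def by (intro continuous_intros)
  have [measurable]: "d \<in> borel_measurable borel"
    using d_cont by (intro borel_measurable_continuous_onI continuous_at_imp_continuous_on) auto
  have d_bound: "0 \<le> d x" "d x \<le> 1" for x
    by (auto simp: d_def)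
  have d_eq_0: "d x = 0 \<longleftrightarrow> x \<in> {0..1}" for x
    by (auto simp: d_def min_def max_def)
  have "(\<integral>x. d x \<partial>\<mu> n) = 0" for n
    using \<mu>_AE[of n] by (intro integral_eq_zero_AE) (simp add: d_eq_0)
  \<comment> \<open>Weak convergence transfers the zero integral of \<open>d\<close>, which forces
    the limit onto the unit interval.\<close>
  then have "(\<integral>x. d x \<partial>M) = 0"
    using limit[OF d_cont] d_bound by (simp add: LIMSEQ_const_iff)
  moreover have "integrable M d"
    using d_bound by (intro M.integrable_const_bound[where B = 1]) auto
  ultimately have "AE x in M. d x = 0"
    using d_bound by (subst (asm) integral_nonneg_eq_0_iff_AE) auto
  then have AE: "AE x in M. x \<in> {0..1}"
    by (simp add: d_eq_0)

  \<comment> \<open>Powers are unbounded on the line, so weak convergence is applied to powers of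
    the clamped variable, which agree with them on the unit interval.\<close>
  define c where "c x = max 0 (min 1 x)" for x :: real
  have c_cont: "isCont (\<lambda>x. c x ^ m) x" for x m
    unfolding c_def by (intro continuous_intros)
  have [measurable]: "c \<in> borel_measurable borel"
    unfolding c_def by measurable
  have c_bound: "0 \<le> c x ^ m" "c x ^ m \<le> 1" for x m
    by (auto simp: c_def intro: power_le_one)
  have c_AE: "AE x in N. c x ^ m = x ^ m" if "AE x in N. x \<in> {0..1}" for N m
    using that by eventually_elim (auto simp: c_def)
  have "(\<integral>x. c x ^ m \<partial>M) = s m" for m
  proof (rule LIMSEQ_unique)
    show "(\<lambda>n. \<integral>x. c x ^ m \<partial>\<mu> (r n)) \<longlonglongrightarrow> (\<integral>x. c x ^ m \<partial>M)"
      using c_bound by (intro limit c_cont) auto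
    have "(\<lambda>n. \<integral>x. c x ^ m \<partial>\<mu> n) \<longlonglongrightarrow> s m"
    proof -
      have "(\<integral>x. c x ^ m \<partial>\<mu> n) = (\<integral>k. (real k / real n) ^ m \<partial>measure_pmf (p n))" for n
        using c_AE[OF \<mu>_AE] unfolding \<mu>_def
        by (subst integral_distr) (auto simp: AE_distr_iff intro!: integral_cong_AE)
      then have "norm ((\<integral>x. c x ^ m \<partial>\<mu> n) - s m) \<le> real m * (real m / (real n - real m))"
        if "2 * m < n" for n
        using bernstein_moment_approx[OF pmf set that] by simp
      then have "\<forall>\<^sub>F n in sequentially.
          norm ((\<integral>x. c x ^ m \<partial>\<mu> n) - s m) \<le> real m * (real m / (real n - real m))"
        using eventually_gt_at_top[of "2 * m"] by (rule eventually_mono[rotated])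
      moreover have "(\<lambda>n. real m * (real m / (real n - real m))) \<longlonglongrightarrow> 0"
        by real_asymp
      ultimately have "(\<lambda>n. (\<integral>x. c x ^ m \<partial>\<mu> n) - s m) \<longlonglongrightarrow> 0"
        by (rule Lim_null_comparison)
      then show ?thesis
        by (rule LIM_zero_cancel)
    qed
    from LIMSEQ_subseq_LIMSEQ[OF this r]
    show "(\<lambda>n. \<integral>x. c x ^ m \<partial>\<mu> (r n)) \<longlonglongrightarrow> s m"
      by (simp add: comp_def)
  qed
  moreover have "integrable M (\<lambda>x. c x ^ m)" for m
    using c_bound by (intro M.integrable_const_bound[where B = 1]) auto
  ultimately have "has_bochner_integral M (\<lambda>x. c x ^ m) (s m)" for m
    by (simp add: has_bochner_integral_iff)
  moreover have "has_bochner_integral M (\<lambda>x. x ^ m) (s m)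
      \<longleftrightarrow> has_bochner_integral M (\<lambda>x. c x ^ m) (s m)" for m
    using c_AE[OF AE, of m] by (intro has_bochner_integral_cong_AE) (auto elim: eventually_mono)
  ultimately have "has_moments M s"
    by (simp add: has_moments_def)
  with M AE show ?thesis
    by (rule that)
qed

text \<open>The Taylor sums \<open>T\<close> of the characteristic function depend on the moments
  alone. Their error at \<open>t\<close> is at most
  \<open>2 * (\<bar>t\<bar> * B) ^ n / fact n\<close>, so they converge to both characteristic
  functions.\<close>

lemma real_distribution_eqI_moments:
  assumes "real_distribution M" "real_distribution N" "has_moments M m" "has_moments N m"
    and AE: "AE x in M. x \<ge> 0" "AE x in N. x \<ge> 0" and bound: "\<And>n. m n \<le> B ^ n"
  shows "M = N"
proof (rule Levy_uniqueness[OF assms(1,2)])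
  show "char M = char N"
  proof
    fix t
    define T where "T n = (\<Sum>k\<le>n. (\<i> * complex_of_real t) ^ k / fact k * complex_of_real (m k))" for n
    have T: "T \<longlonglongrightarrow> char K t" if "real_distribution K" "has_moments K m" "AE x in K. x \<ge> 0" for K
    proof -
      interpret real_distribution K by fact
      have int: "integrable K (\<lambda>x. x ^ n)" "expectation (\<lambda>x. x ^ n) = m n" for n
        using that(2) by (auto simp: has_moments_def has_bochner_integral_iff)
      have "norm (T n - char K t) \<le> 2 * ((\<bar>t\<bar> * B) ^ n / fact n)" for n
      proof -
        have "norm (T n - char K t) \<le> 2 * \<bar>t\<bar> ^ n / fact n * expectation (\<lambda>x. \<bar>x\<bar> ^ n)"
          using char_approx1[of n t] by (simp add: int T_def norm_minus_commute)
        \<comment> \<open>Nonnegativity identifies absolute moments with moments, to which the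
          growth bound applies.\<close>
        also have "expectation (\<lambda>x. \<bar>x\<bar> ^ n) = expectation (\<lambda>x. x ^ n)"
          using that(3) by (intro integral_cong_AE) auto
        also have "2 * \<bar>t\<bar> ^ n / fact n * \<dots> \<le> 2 * \<bar>t\<bar> ^ n / fact n * B ^ n"
          using bound by (intro mult_left_mono) (auto simp: int)
        finally show ?thesis
          by (simp add: power_mult_distrib)
      qed
      moreover have "(\<lambda>n. 2 * ((\<bar>t\<bar> * B) ^ n / fact n)) \<longlonglongrightarrow> 0"
        using summable_LIMSEQ_zero[OF summable_exp[of "\<bar>t\<bar> * B"]]
        by (intro tendsto_mult_right_zero) (simp add: divide_inverse mult.commute)
      ultimately have "(\<lambda>n. T n - char K t) \<longlonglongrightarrow> 0"
        by (rule Lim_null_comparison[OF always_eventually[OF allI]])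
      then show ?thesis
        by (rule LIM_zero_cancel)
    qed
    show "char M t = char N t"
      using T[OF assms(1,3) AE(1)] T[OF assms(2,4) AE(2)] by (rule LIMSEQ_unique)
  qed
qed

section \<open>Counting walks\<close>

text \<open>Distinct endpoints are allowed because removing the first step of a closed walk need not
  leave a closed walk.\<close>

definition walks ::
    "'e set \<Rightarrow> ('e \<Rightarrow> 'v set) \<Rightarrow> 'v \<Rightarrow> 'v \<Rightarrow> nat \<Rightarrow> ('v list \<times> 'e list) set" where
  "walks E ends u v n =
     {(vs, es). length vs = Suc n \<and> length es = n \<and> vs ! 0 = u \<and> vs ! n = v \<and>
        (\<forall>i<n. es ! i \<in> E \<and> ends (es ! i) = {vs ! i, vs ! Suc i})}"

definition edges_between :: "'e set \<Rightarrow> ('e \<Rightarrow> 'v set) \<Rightarrow> 'v \<Rightarrow> 'v \<Rightarrow> 'e set" where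
  "edges_between E ends u x = {e \<in> E. ends e = {u, x}}"

lemma closed_walks_eq_walks: "closed_walks E ends v n = walks E ends v v n"
  by (simp add: closed_walks_def walks_def)

lemma walks_0: "walks E ends u v 0 = (if u = v then {([v], [])} else {})"
  by (auto simp: walks_def length_Suc_conv)

text \<open>The end \<open>v\<close> stays fixed while the start varies, matching one application of
  the adjacency operator to a function of the start.\<close>

lemma walks_Suc:
  "walks E ends u v (Suc n) =
     (\<Union>x. (\<lambda>(e, vs, es). (u # vs, e # es)) ` (edges_between E ends u x \<times> walks E ends x v n))"
  (is "?L = ?R")
proof
  show "?L \<subseteq> ?R"
  proof
    fix w assume "w \<in> ?L"
    then obtain vs' es' where w: "w = (vs', es')" "length vs' = Suc (Suc n)" "length es' = Suc n"
      "vs' ! 0 = u" "vs' ! Suc n = v"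
      and step: "\<And>i. i < Suc n \<Longrightarrow> es' ! i \<in> E \<and> ends (es' ! i) = {vs' ! i, vs' ! Suc i}"
      unfolding walks_def by blast
    obtain vs where vs: "vs' = u # vs"
      using w by (cases vs') auto
    obtain e es where es: "es' = e # es"
      using w by (cases es') auto
    have "e \<in> edges_between E ends u (vs ! 0)"
      using step[of 0] by (simp add: edges_between_def vs es)
    moreover have "(vs, es) \<in> walks E ends (vs ! 0) v n"
      using w step[of "Suc i" for i] by (simp add: walks_def vs es)
    ultimately show "w \<in> ?R"
      unfolding w(1) vs es by (intro UN_I[of "vs ! 0"] image_eqI[of _ _ "(e, vs, es)"]) simp_all
  qed
  show "?R \<subseteq> ?L"
  proof
    fix w assume "w \<in> ?R"
    then obtain x e vs es where w: "w = (u # vs, e # es)" "e \<in> edges_between E ends u x"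
      "(vs, es) \<in> walks E ends x v n"
      by auto
    then show "w \<in> ?L"
      by (simp add: walks_def edges_between_def All_less_Suc2)
  qed
qed

locale bounded_degree_graph = undirected_graph V E ends
  for V :: "'v set" and E :: "'e set" and ends :: "'e \<Rightarrow> 'v set" +
  fixes C :: nat
  assumes degree: "v \<in> V \<Longrightarrow> degree_at_most E ends C v"
begin

abbreviation multiplicity :: "'v \<Rightarrow> 'v \<Rightarrow> nat" where
  "multiplicity u x \<equiv> card (edges_between E ends u x)"

lemma finite_edges_between: "finite (edges_between E ends u x)"
proof (cases "u \<in> V")
  case True
  then have "finite (incident_edges E ends u)"
    using degree by (simp add: degree_at_most_def)
  then show ?thesis
    by (rule rev_finite_subset) (auto simp: edges_between_def incident_edges_def)
next
  case False
  then have "edges_between E ends u x = {}"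
    using ends_subset by (fastforce simp: edges_between_def)
  then show ?thesis by simp
qed

lemma multiplicity_commute: "multiplicity u x = multiplicity x u"
  by (simp add: edges_between_def insert_commute)

text \<open>The sets of edges from \<open>u\<close> to different \<open>x\<close> are disjoint, and
  a self-edge counts once on both sides. This supplies the row sum bound.\<close>

lemma sum_multiplicity_le:
  assumes "finite S" "u \<in> V"
  shows "(\<Sum>x\<in>S. multiplicity u x) \<le> C"
proof -
  have "(\<Sum>x\<in>S. multiplicity u x) = card (\<Union>x\<in>S. edges_between E ends u x)"
    using assms(1) finite_edges_between
    by (subst card_UN_disjoint) (auto simp: edges_between_def doubleton_eq_iff)
  also have "\<dots> \<le> card (incident_edges E ends u)"
    using degree[OF assms(2)]
    by (intro card_mono) (auto simp: degree_at_most_def edges_between_def incident_edges_def)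
  also have "\<dots> \<le> C"
    using degree[OF assms(2)] by (simp add: degree_at_most_def)
  finally show ?thesis .
qed

text \<open>Starts of longer walks are neighbours of starts of shorter ones. Containment in
  \<open>V\<close> is carried through the induction because the degree bound holds only
  there.\<close>

lemma finite_walk_starts:
  assumes "v \<in> V"
  shows "finite {u. walks E ends u v n \<noteq> {}} \<and> {u. walks E ends u v n \<noteq> {}} \<subseteq> V"
proof (induction n)
  case 0
  then show ?case
    using assms by (auto simp: walks_0)
next
  case (Suc n)
  let ?R = "{u. walks E ends u v n \<noteq> {}}"
  let ?I = "\<Union>x\<in>?R. \<Union> (ends ` incident_edges E ends x)"
  have "{u. walks E ends u v (Suc n) \<noteq> {}} \<subseteq> ?I"
    by (auto simp: walks_Suc edges_between_def incident_edges_def)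
  moreover have "?I \<subseteq> V"
    using ends_subset by (auto simp: incident_edges_def)
  moreover have "finite ?I"
  proof (intro finite_UN_I)
    show "finite ?R"
      using Suc by blast
    show "finite (incident_edges E ends x)" if "x \<in> ?R" for x
      using that Suc degree by (auto simp: degree_at_most_def)
    show "finite (ends e)" if "e \<in> incident_edges E ends x" for e x
      using that card_ends[of e] by (auto simp: incident_edges_def intro: card_ge_0_finite)
  qed
  ultimately show ?case
    by (meson finite_subset order_trans)
qed

lemma finite_walks: "finite (walks E ends u v n)" if "v \<in> V"
proof (induction n arbitrary: u)
  case (Suc n)
  have "walks E ends u v (Suc n) = (\<Union>x\<in>{x. walks E ends x v n \<noteq> {}}.
      (\<lambda>(e, vs, es). (u # vs, e # es)) ` (edges_between E ends u x \<times> walks E ends x v n))"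
    unfolding walks_Suc by blast
  then show ?case
    using Suc finite_walk_starts[OF that] finite_edges_between by auto
qed (simp add: walks_0)

lemma card_walks_Suc:
  assumes "v \<in> V" "finite S" "{x. walks E ends x v n \<noteq> {}} \<subseteq> S"
  shows "card (walks E ends u v (Suc n)) = (\<Sum>x\<in>S. multiplicity u x * card (walks E ends x v n))"
proof -
  let ?f = "\<lambda>(e, vs, es). (u # vs, e # es)"
  let ?W = "\<lambda>x. ?f ` (edges_between E ends u x \<times> walks E ends x v n)"
  have "walks E ends u v (Suc n) = (\<Union>x\<in>S. ?W x)"
    unfolding walks_Suc using assms(3) by blast
  moreover have "?W x \<inter> ?W y = {}" if "x \<noteq> y" for x y
    using that by (auto simp: walks_def)
  ultimately have "card (walks E ends u v (Suc n)) = (\<Sum>x\<in>S. card (?W x))"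
    using assms finite_walks finite_edges_between by (simp add: card_UN_disjoint)
  also have "\<dots> = (\<Sum>x\<in>S. multiplicity u x * card (walks E ends x v n))"
    by (intro sum.cong refl, subst card_image) (auto simp: inj_on_def card_cartesian_product)
  finally show ?thesis .
qed

lemma backward_difference_num_loops_nonneg:
  assumes "v0 \<in> V" "C > 0"
  shows "backward_difference l (\<lambda>n. real (num_loops E ends v0 (2 * n)) / real C ^ (2 * n)) k \<ge> 0"
proof -
  \<comment> \<open>The difference involves \<open>s\<close> up to index \<open>k + l\<close>, hence
    walks of length up to twice that.\<close>
  define N where "N = 2 * (k + l)"
  define S where "S = (\<Union>n\<le>N. {x. walks E ends x v0 n \<noteq> {}})"
  define a where "a u x = real (multiplicity u x) / real C" for u x
  have S: "finite S" "S \<subseteq> V"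
    using finite_walk_starts[OF assms(1)] by (auto simp: S_def)
  have "v0 \<in> S"
    by (auto simp: S_def walks_0 intro!: bexI[of _ 0])
  interpret symmetric_contraction S a
  proof
    show "(\<Sum>x\<in>S. a u x) \<le> 1" if "u \<in> S" for u
    proof -
      have "real (\<Sum>x\<in>S. multiplicity u x) \<le> real C"
        using that S sum_multiplicity_le by (intro of_nat_mono) auto
      then show ?thesis
        using assms(2) by (simp add: a_def flip: sum_divide_distrib)
    qed
  qed (auto simp: a_def S multiplicity_commute)
  define e where "e u = (if u = v0 then 1 else 0 :: real)" for u
  \<comment> \<open>Restricting to \<open>S\<close> loses no walk: after its first step, a walk of
    length \<open>Suc n \<le> N\<close> continues from a start of a walk of length \<open>n\<close>,
    which lies in \<open>S\<close>.\<close>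
  have A_e: "(A ^^ n) e u = real (card (walks E ends u v0 n)) / real C ^ n" if "n \<le> N" for n u
    using that
  proof (induction n arbitrary: u)
    case 0
    then show ?case by (simp add: e_def walks_0)
  next
    case (Suc n)
    have "{x. walks E ends x v0 n \<noteq> {}} \<subseteq> S"
      using Suc.prems by (auto simp: S_def)
    with Suc show ?case
      by (simp add: card_walks_Suc[OF assms(1) S(1)] sum_operator_def a_def sum_divide_distrib mult.commute)
  qed
  have "sum_inner S ((A ^^ n) e) e = real (num_loops E ends v0 n) / real C ^ n" if "n \<le> N" for n
    using that S \<open>v0 \<in> S\<close>
    by (simp add: sum_inner_def A_e e_def num_loops_def closed_walks_eq_walks if_distrib cong: if_cong)
  then have "backward_difference l (\<lambda>n. real (num_loops E ends v0 (2 * n)) / real C ^ (2 * n)) k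
      = backward_difference l (\<lambda>n. sum_inner S ((A ^^ (2 * n)) e) e) k"
    by (intro backward_difference_cong) (simp add: N_def)
  then show ?thesis
    using backward_difference_inner_nonneg by simp
qed

end

section \<open>The spectral measure of the base vertex\<close>

lemma borel_measure_on_nonnegD:
  assumes "borel_measure_on_nonneg \<mu>"
  shows "space \<mu> = {0..}" "(\<lambda>x. x) \<in> borel_measurable \<mu>"
proof -
  have *: "sets \<mu> = sets (restrict_space borel {0..})"
    using assms by (simp add: borel_measure_on_nonneg_def)
  show "space \<mu> = {0..}"
    using sets_eq_imp_space_eq[OF *] by (simp add: space_restrict_space)
  show "(\<lambda>x. x) \<in> borel_measurable \<mu>"
    unfolding measurable_cong_sets[OF * refl] by (rule measurable_restrict_space1) simp
qed

text \<open>Borel subsets of the half-line are Borel in the line, so inclusion loses nothing. This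
  carries uniqueness over from laws on the line, where characteristic functions are
  available.\<close>

lemma measure_eqI_distr_borel:
  assumes "borel_measure_on_nonneg \<mu>" "borel_measure_on_nonneg \<nu>"
    and "distr \<mu> borel (\<lambda>x. x) = distr \<nu> borel (\<lambda>x. x)"
  shows "\<mu> = \<nu>"
proof (rule measure_eqI)
  show "sets \<mu> = sets \<nu>"
    using assms by (simp add: borel_measure_on_nonneg_def)
  fix A assume A: "A \<in> sets \<mu>"
  then have "A \<subseteq> {0..}" "A \<in> sets borel"
    using assms(1) by (auto simp: borel_measure_on_nonneg_def sets_restrict_space_iff)
  then have "emeasure K A = emeasure (distr K borel (\<lambda>x. x)) A" if "borel_measure_on_nonneg K" for K
    using borel_measure_on_nonnegD[OF that] by (simp add: emeasure_distr Int_absorb2)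
  then show "emeasure \<mu> A = emeasure \<nu> A"
    using assms by metis
qed

theorem theorem4p4:
  fixes V :: "'v set" and E :: "'e set" and ends :: "'e \<Rightarrow> 'v set"
    and v0 :: 'v and C :: nat and t :: "nat \<Rightarrow> nat"
  assumes "undirected_graph V E ends"
    and "v0 \<in> V"
    and "C > 0"
    and "\<forall>v\<in>V. degree_at_most E ends C v"
    and t_def: "\<forall>n. t n = num_loops E ends v0 n"
  shows "(\<exists>\<mu>. prob_space \<mu> \<and> borel_measure_on_nonneg \<mu>
            \<and> has_moments \<mu> (\<lambda>n. real (t (2 * n)))
            \<and> measure_support \<mu> \<subseteq> {0..(real C)\<^sup>2}
            \<and> (\<forall>\<nu>. prob_space \<nu> \<and> borel_measure_on_nonneg \<nu>
                   \<and> has_moments \<nu> (\<lambda>n. real (t (2 * n))) \<longrightarrow> \<nu> = \<mu>))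
       \<and> stieltjes_moment_sequence (\<lambda>n. real (t (2 * n)))"
proof -
  interpret bounded_degree_graph V E ends C
    using assms(1,4) by (simp add: bounded_degree_graph_def bounded_degree_graph_axioms_def)
  define s where "s n = real (t (2 * n)) / real C ^ (2 * n)" for n
  have s0: "s 0 = 1"
    by (simp add: s_def t_def num_loops_0)
  have s_mono: "backward_difference l s k \<ge> 0" for l k
    using backward_difference_num_loops_nonneg[OF assms(2,3), of l k]
    by (simp add: s_def[abs_def] t_def)
  have moment: "real (t (2 * n)) = ((real C)\<^sup>2) ^ n * s n" for n
    using assms(3) by (simp add: s_def power_mult)
  \<comment> \<open>Nonnegative first differences make \<open>s\<close> decrease from 1; this yields
    the geometric bound for uniqueness.\<close>
  have "s n \<le> 1" for n
  proof (induction n)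
    case (Suc n)
    then show ?case using s_mono[of 1 n] by simp
  qed (simp add: s0)
  then have t_bound: "real (t (2 * n)) \<le> ((real C)\<^sup>2) ^ n" for n
    by (simp add: moment mult_left_le)

  obtain M where "real_distribution M" and M_AE: "AE x in M. x \<in> {0..1}" and M_moments: "has_moments M s"
    using hausdorff_moment_problem[OF s0 s_mono] by blast
  interpret M: real_distribution M by fact
  \<comment> \<open>\<open>M\<close> is a measure on the whole line, so \<open>max 0 x\<close> is
    what makes \<open>g\<close> land in the half-line everywhere; almost surely it is just
    \<open>x\<close>.\<close>
  define g where "g x = (real C)\<^sup>2 * max 0 x" for x
  have g: "g \<in> measurable M (restrict_space borel {0..})"
    unfolding g_def by (intro measurable_restrict_space2) auto
  have g_power: "(\<lambda>x. x ^ n) \<in> borel_measurable (restrict_space borel {0::real..})" for n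
    by (intro measurable_restrict_space1) simp
  define \<mu> where "\<mu> = distr M (restrict_space borel {0..}) g"
  have prob: "prob_space \<mu>"
    unfolding \<mu>_def by (rule M.prob_space_distr[OF g])
  have nonneg: "borel_measure_on_nonneg \<mu>"
    by (simp add: borel_measure_on_nonneg_def \<mu>_def)
  have moments: "has_moments \<mu> (\<lambda>n. real (t (2 * n)))"
    unfolding has_moments_def
  proof
    fix n
    have "has_bochner_integral M (\<lambda>x. ((real C)\<^sup>2) ^ n * x ^ n) (((real C)\<^sup>2) ^ n * s n)"
      using M_moments by (intro has_bochner_integral_mult_right) (simp add: has_moments_def)
    moreover have "AE x in M. g x ^ n = ((real C)\<^sup>2) ^ n * x ^ n"
      using M_AE by eventually_elim (simp add: g_def power_mult_distrib)
    ultimately have "has_bochner_integral M (\<lambda>x. g x ^ n) (((real C)\<^sup>2) ^ n * s n)"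
      by (subst has_bochner_integral_cong_AE) (auto simp: g_def)
    then show "has_bochner_integral \<mu> (\<lambda>x. x ^ n) (real (t (2 * n)))"
      unfolding \<mu>_def moment
      by (simp add: has_bochner_integral_iff integrable_distr_eq[OF g g_power] integral_distr[OF g g_power])
  qed
  have support: "measure_support \<mu> \<subseteq> {0..(real C)\<^sup>2}"
  proof
    fix x assume x: "x \<in> measure_support \<mu>"
    \<comment> \<open>This open set is null because \<open>g\<close> is almost surely at most
      \<open>C^2\<close>, so it contains no support point.\<close>
    let ?U = "{(real C)\<^sup>2<..}"
    have space: "space \<mu> = {0..}"
      by (simp add: \<mu>_def space_restrict_space)
    have "emeasure \<mu> (?U \<inter> space \<mu>) = emeasure M (g -` (?U \<inter> {0..}) \<inter> space M)"
      unfolding space unfolding \<mu>_def by (intro emeasure_distr g) (auto simp: sets_restrict_space_iff)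
    also have "\<dots> = emeasure M {x \<in> space M. g x > (real C)\<^sup>2}"
      by (rule arg_cong[where f = "emeasure M"]) (auto simp: g_def)
    also have "\<dots> = 0"
    proof (rule emeasure_eq_0_AE)
      show "AE x in M. \<not> g x > (real C)\<^sup>2"
        using M_AE by eventually_elim (simp add: g_def not_less mult_left_le)
    qed
    finally have "x \<notin> ?U"
      using x open_greaterThan unfolding measure_support_def
      by (metis (no_types, lifting) less_irrefl mem_Collect_eq)
    then show "x \<in> {0..(real C)\<^sup>2}"
      using x by (auto simp: measure_support_def space)
  qed
  have unique: "\<nu> = \<mu>" if \<nu>: "prob_space \<nu>" "borel_measure_on_nonneg \<nu>"
    "has_moments \<nu> (\<lambda>n. real (t (2 * n)))" for \<nu>
    using \<nu>(2) nonneg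
  proof (rule measure_eqI_distr_borel)
    \<comment> \<open>Inclusion into the line preserves moments and nonnegativity, so determinacy
      with \<open>B = C^2\<close> applies to both images.\<close>
    have "real_distribution (distr K borel (\<lambda>x. x)) \<and> (AE x in distr K borel (\<lambda>x. x). 0 \<le> x)
        \<and> has_moments (distr K borel (\<lambda>x. x)) (\<lambda>n. real (t (2 * n)))"
      if "prob_space K" "borel_measure_on_nonneg K" "has_moments K (\<lambda>n. real (t (2 * n)))" for K
    proof -
      interpret K: prob_space K by fact
      note id = borel_measure_on_nonnegD(2)[OF that(2)]
      have "AE x in K. 0 \<le> x"
        using borel_measure_on_nonnegD(1)[OF that(2)] by (intro AE_I2) simp
      then show ?thesis
        using that(3) K.real_distribution_distr[OF id]
        by (simp add: AE_distr_iff[OF id] has_moments_def has_bochner_integral_iff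
            integrable_distr_eq[OF id] integral_distr[OF id])
    qed
    then show "distr \<nu> borel (\<lambda>x. x) = distr \<mu> borel (\<lambda>x. x)"
      using \<nu> prob nonneg moments t_bound by (intro real_distribution_eqI_moments) blast+
  qed
  show ?thesis
    unfolding stieltjes_moment_sequence_def
    using prob nonneg moments support unique by blast
qed

end
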